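(* Let $E=\mathbf{F}_4$, let $\sigma$ be the nontrivial automorphism of $E$ (so $a^{\sigma}=a^2$), let $\omega\in E\setminus\mathbf{F}_2$ be a fixed element, and let $A=E\oplus E=\{(a,b)\mid a,b\in E\}$ be the four-dimensional (non-associative) algebra over $\mathbf{F}_2$ with multiplication $$(a,b)(c,d)=(ac+\omega b^{\sigma}d,\; bc+a^{\sigma}d).$$ Regard $A$ as a two-sided vector space over $E$ by left multiplication $k(a,b)=(ka,k^{\sigma}b)$ and right multiplication $(a,b)k=(ak,bk)$ for $k\in E$. Let $x,y,x',y'\in A$ be nonzero elements. Then $A(x,y)=A(x',y')$ if and only if either of the following holds: (i) $x'=kx$ and $y'=ky$ for some $k\in E^{\times}$. (ii) $x=ym$ and $x'=y'm$ for some $m\in E^{\times}$.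
   Context: For an algebra $A$ (a vector space with bilinear, not necessarily associative, multiplication) and $(x,y)\in A^2=A\oplus A$, let $A$ act on $A^2$ by $a(x,y)=(ax,ay)$ and put $A(x,y)=\{(ax,ay)\mid a\in A\}\subset A^2$. *)

theory Defs
  imports "HOL-Library.Cardinality" "HOL-Library.Product_Plus"
begin

definition field_automorphism :: "('e::field \<Rightarrow> 'e) \<Rightarrow> bool" where
  "field_automorphism \<sigma> \<longleftrightarrow>
     bij \<sigma> \<and> \<sigma> 1 = 1 \<and>
     (\<forall>a b. \<sigma> (a + b) = \<sigma> a + \<sigma> b) \<and>
     (\<forall>a b. \<sigma> (a * b) = \<sigma> a * \<sigma> b)"

definition alg_mult :: "('e::field \<Rightarrow> 'e) \<Rightarrow> 'e \<Rightarrow> 'e \<times> 'e \<Rightarrow> 'e \<times> 'e \<Rightarrow> 'e \<times> 'e" where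
  "alg_mult \<sigma> \<omega> = (\<lambda>(a, b) (c, d). (a * c + \<omega> * \<sigma> b * d, b * c + \<sigma> a * d))"

definition left_scale :: "('e::field \<Rightarrow> 'e) \<Rightarrow> 'e \<Rightarrow> 'e \<times> 'e \<Rightarrow> 'e \<times> 'e" where
  "left_scale \<sigma> k = (\<lambda>(a, b). (k * a, \<sigma> k * b))"

definition right_scale :: "'e::field \<times> 'e \<Rightarrow> 'e \<Rightarrow> 'e \<times> 'e" where
  "right_scale = (\<lambda>(a, b) k. (a * k, b * k))"

text \<open>For an algebra with multiplication \<open>mul\<close> whose elements are exactly those of the type,
  this is the set \<open>A(x, y) = {(a x, a y) | a \<in> A}\<close>.\<close>

definition alg_span :: "('a \<Rightarrow> 'a \<Rightarrow> 'a) \<Rightarrow> 'a \<Rightarrow> 'a \<Rightarrow> ('a \<times> 'a) set" where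
  "alg_span mul x y = {(mul a x, mul a y) | a. True}"

end

theory Submission
  imports Defs
begin

text \<open>
  Write \<open>x = (c, d)\<close> and \<open>y = (e, f)\<close>. In the left \<open>E\<close>-coordinates \<open>(a, \<sigma> b)\<close> of an element
  \<open>(a, b)\<close> of \<open>A\<close>, right multiplication by \<open>y\<close> is a matrix over \<open>E\<close> whose determinant
  \<open>\<delta> = e \<sigma>(e) + \<omega> f \<sigma>(f)\<close> vanishes only for \<open>y = 0\<close>, because norms of \<open>E\<close> lie in \<open>{0, 1}\<close> and
  \<open>\<omega>\<close> does not. Its adjugate is again a right multiplication, by the conjugate \<open>(\<sigma>(e), f)\<close>. So
  \<open>A(x, y)\<close> is the graph of the left \<open>E\<close>-linear map \<open>ay \<mapsto> ax\<close>, and \<open>\<delta>\<close> times this map is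
  right multiplication by the conjugate of \<open>y\<close> followed by that by \<open>x\<close>. Two spans agree if and
  only if these maps do.

  Evaluating on \<open>(1, 0)\<close> and \<open>(0, 1)\<close> gives the matrix of the map. Its off-diagonal entries are, up
  to \<open>\<omega>\<close> and \<open>\<sigma>\<close>, the cross term \<open>Q = cf + de\<close>, and its diagonal entries are two independent
  combinations of \<open>\<sigma>(e) c\<close> and \<open>\<sigma>(f) d\<close>, all divided by \<open>\<delta>\<close> (or \<open>\<sigma>(\<delta>)\<close>).

  If \<open>Q = 0\<close> for one pair, then it vanishes for the other, and both \<open>x\<close> and \<open>x'\<close> are right multiples
  of \<open>y\<close> and \<open>y'\<close>; the spans are then graphs of right scalings, and the scalars agree: this is the
  second alternative. If \<open>Q \<noteq> 0\<close>, then the ratio of the two determinants is fixed by \<open>\<sigma>\<close>, hence is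
  \<open>1\<close>; equal determinants also mean that the same coordinates of \<open>y\<close> and \<open>y'\<close> vanish. The values
  \<open>\<sigma>(e) c\<close>, \<open>\<sigma>(f) d\<close> and \<open>Q\<close> of the two pairs therefore agree. As \<open>\<sigma>(k) k = 1\<close> for \<open>k \<noteq> 0\<close>, the
  first forces \<open>(c', e') = k (c, e)\<close>, the second \<open>(d', f') = l (d, f)\<close>, and the third \<open>k l = 1\<close>,
  that is \<open>l = \<sigma>(k)\<close>: this is the first alternative.

  Conversely, \<open>a(kx) = (ak)x\<close> shows that left scaling of both elements preserves the span, and
  \<open>a(ym) = (ay)m\<close> that the span of \<open>ym\<close> and \<open>y\<close> is the graph of right scaling by \<open>m\<close>,
  whatever the nonzero \<open>y\<close> is.
\<close>

section \<open>The field with four elements\<close>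

text \<open>Multiplication by a nonzero element permutes the three nonzero elements, so it does not
  change their product.\<close>

lemma cube_eq_one:
  fixes a :: "'e::field"
  assumes "CARD('e) = 4" "a \<noteq> 0"
  shows "a ^ 3 = 1"
proof -
  let ?U = "UNIV - {0::'e}"
  have fin: "finite (UNIV :: 'e set)"
    using assms(1) by (intro card_ge_0_finite) simp
  have card: "card ?U = 3"
    using assms(1) by (simp add: card_Diff_singleton)
  have "bij_betw ((*) a) ?U ?U"
    by (rule bij_betw_byWitness[where f' = "\<lambda>b. b / a"]) (use assms(2) in auto)
  then have "\<Prod>?U = (\<Prod>b\<in>?U. a * b)"
    by (simp add: prod.reindex_bij_betw[where g = "\<lambda>b. b"])
  also have "\<dots> = a ^ 3 * \<Prod>?U"
    by (simp add: prod.distrib card)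
  finally show ?thesis
    using fin by (auto simp: prod_zero_iff)
qed

lemma char_two:
  fixes a :: "'e::field"
  assumes "CARD('e) = 4"
  shows "a + a = 0"
proof -
  have "(- 1 :: 'e) ^ 3 = 1"
    by (rule cube_eq_one[OF assms]) simp
  then have "(1::'e) + 1 = 0"
    by (simp add: power3_eq_cube eq_neg_iff_add_eq_0 neg_eq_iff_add_eq_0)
  then show ?thesis
    by (metis distrib_left mult.right_neutral mult_zero_right)
qed

lemma UNIV_powers:
  fixes b :: "'e::field"
  assumes "CARD('e) = 4" "b \<noteq> 0" "b \<noteq> 1"
  shows "UNIV = {0, 1, b, b\<^sup>2}"
proof -
  have fin: "finite (UNIV :: 'e set)"
    using assms(1) by (intro card_ge_0_finite) simp
  have "b * b\<^sup>2 = 1"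
    using cube_eq_one[OF assms(1,2)] by (simp add: power3_eq_cube power2_eq_square mult.assoc)
  then have "b\<^sup>2 \<noteq> 1"
    using assms(3) by auto
  moreover have "b\<^sup>2 \<noteq> b"
    using assms(2,3) by (simp add: power2_eq_square)
  ultimately have "card {0, 1, b, b\<^sup>2} = CARD('e)"
    using assms by auto
  then show ?thesis
    using card_subset_eq[OF fin, of "{0, 1, b, b\<^sup>2}"] by simp
qed

text \<open>An element \<open>b\<close> moved by \<open>\<sigma>\<close> must go to the only remaining element \<open>b\<^sup>2\<close>, and it generates
  the multiplicative group.\<close>

lemma automorphism_eq_square:
  fixes \<sigma> :: "'e::field \<Rightarrow> 'e"
  assumes card: "CARD('e) = 4" and aut: "field_automorphism \<sigma>" and "\<sigma> \<noteq> id"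
  shows "\<sigma> a = a\<^sup>2"
proof -
  have one: "\<sigma> 1 = 1" and inj: "\<And>u v. \<sigma> u = \<sigma> v \<Longrightarrow> u = v"
    and add: "\<And>u v. \<sigma> (u + v) = \<sigma> u + \<sigma> v"
    and mult: "\<And>u v. \<sigma> (u * v) = \<sigma> u * \<sigma> v"
    using aut by (auto simp: field_automorphism_def bij_def inj_def)
  have zero: "\<sigma> 0 = 0"
    using add[of 0 0] by (metis add.right_neutral add_left_cancel)
  obtain b where b: "\<sigma> b \<noteq> b"
    using \<open>\<sigma> \<noteq> id\<close> by (auto simp: fun_eq_iff)
  then have b01: "b \<noteq> 0" "b \<noteq> 1"
    using one zero by auto
  have cases: "z = 0 \<or> z = 1 \<or> z = b \<or> z = b\<^sup>2" for z
    using UNIV_powers[OF card b01] by blast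
  have \<sigma>b: "\<sigma> b = b\<^sup>2"
    using cases[of "\<sigma> b"] b b01 inj[of b 0] inj[of b 1] one zero by auto
  moreover have "\<sigma> (b\<^sup>2) = (b\<^sup>2)\<^sup>2"
    using \<sigma>b mult[of b b] by (simp add: power2_eq_square)
  ultimately show ?thesis
    using cases[of a] one zero by auto
qed

section \<open>Conjugation and the graph description of spans\<close>

locale quartic_algebra =
  fixes \<sigma> :: "'e::field \<Rightarrow> 'e" and \<omega> :: 'e
  assumes card: "CARD('e) = 4"
    and aut: "field_automorphism \<sigma>" and nontrivial: "\<sigma> \<noteq> id"
    and \<omega>: "\<omega> \<notin> {0, 1}"
begin

abbreviation mul :: "'e \<times> 'e \<Rightarrow> 'e \<times> 'e \<Rightarrow> 'e \<times> 'e" (infixl "\<odot>" 70) where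
  "x \<odot> y \<equiv> alg_mult \<sigma> \<omega> x y"

abbreviation span :: "'e \<times> 'e \<Rightarrow> 'e \<times> 'e \<Rightarrow> (('e \<times> 'e) \<times> 'e \<times> 'e) set" where
  "span \<equiv> alg_span (alg_mult \<sigma> \<omega>)"

definition conjugate :: "'e \<times> 'e \<Rightarrow> 'e \<times> 'e" where
  "conjugate y = (\<sigma> (fst y), snd y)"

definition det :: "'e \<times> 'e \<Rightarrow> 'e" where
  "det y = fst y * \<sigma> (fst y) + \<omega> * snd y * \<sigma> (snd y)"

lemma sigma_square: "\<sigma> a = a\<^sup>2"
  by (rule automorphism_eq_square[OF card aut nontrivial])

lemma sigma_add: "\<sigma> (a + b) = \<sigma> a + \<sigma> b"
  and sigma_mult: "\<sigma> (a * b) = \<sigma> a * \<sigma> b"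
  using aut by (auto simp: field_automorphism_def)

lemma sigma_zero [simp]: "\<sigma> 0 = 0" and sigma_one [simp]: "\<sigma> 1 = 1"
  and sigma_eq_0_iff [simp]: "\<sigma> a = 0 \<longleftrightarrow> a = 0"
  by (simp_all add: sigma_square)

lemma norm_eq: "a * \<sigma> a = of_bool (a \<noteq> 0)"
  using cube_eq_one[OF card, of a]
  by (auto simp: sigma_square power2_eq_square power3_eq_cube mult.assoc)

lemma sigma_eq_inverse: "k \<noteq> 0 \<Longrightarrow> \<sigma> k = inverse k"
  using norm_eq[of k] by (simp add: inverse_unique)

lemma sigma_sigma: "\<sigma> (\<sigma> a) = a"
  by (cases "a = 0") (simp_all add: sigma_eq_inverse)

lemma add_self [simp]: "(a::'e) + a = 0" "a + (a + b) = b"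
  using char_two[OF card] by (simp_all add: add.assoc[symmetric])

lemma add_eq_0_iff_eq: "(a::'e) + b = 0 \<longleftrightarrow> a = b"
  by (metis add_self)

lemmas twisted_simps = sigma_add sigma_mult sigma_sigma algebra_simps

lemmas algebra_defs = alg_mult_def left_scale_def right_scale_def

lemma det_eq: "det y = of_bool (fst y \<noteq> 0) + \<omega> * of_bool (snd y \<noteq> 0)"
  by (simp add: det_def norm_eq mult.assoc)

lemma det_nonzero: "y \<noteq> 0 \<Longrightarrow> det y \<noteq> 0"
  using \<omega> by (auto simp: det_eq add_eq_0_iff_eq prod_eq_iff)

text \<open>The four possible values \<open>0, 1, \<omega>, 1 + \<omega>\<close> of the determinant are distinct, so it
  determines which coordinates vanish.\<close>

lemma det_eq_support:
  assumes "det y = det y'"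
  shows "fst y = 0 \<longleftrightarrow> fst y' = 0" "snd y = 0 \<longleftrightarrow> snd y' = 0"
proof -
  have "1 + \<omega> \<noteq> 0" "1 + \<omega> \<noteq> 1" "1 + \<omega> \<noteq> \<omega>"
    using \<omega> by (auto simp: add_eq_0_iff_eq)
  then show "fst y = 0 \<longleftrightarrow> fst y' = 0" "snd y = 0 \<longleftrightarrow> snd y' = 0"
    using assms \<omega> by (auto simp: det_eq of_bool_def split: if_splits)
qed

lemma conjugate_conjugate: "conjugate (conjugate y) = y"
  and det_conjugate: "det (conjugate y) = det y"
  by (simp_all add: conjugate_def det_def sigma_sigma mult.commute)

text \<open>Right multiplication by \<open>conjugate y\<close> is the adjugate of right multiplication by \<open>y\<close>.\<close>

lemma mul_conjugate: "(a \<odot> y) \<odot> conjugate y = left_scale \<sigma> (det y) a"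
  by (cases a; cases y) (simp add: algebra_defs conjugate_def det_def twisted_simps)

lemma conjugate_mul: "(a \<odot> conjugate y) \<odot> y = left_scale \<sigma> (det y) a"
  using mul_conjugate[of a "conjugate y"] by (simp add: conjugate_conjugate det_conjugate)

lemma left_scale_mul: "left_scale \<sigma> k a \<odot> x = left_scale \<sigma> k (a \<odot> x)"
  and mul_left_scale: "a \<odot> left_scale \<sigma> k x = right_scale a k \<odot> x"
  and mul_right_scale: "a \<odot> right_scale x k = right_scale (a \<odot> x) k"
  by (cases a; cases x; simp add: algebra_defs twisted_simps)+

lemma left_scale_left_scale: "left_scale \<sigma> k (left_scale \<sigma> l a) = left_scale \<sigma> (k * l) a"
  and left_scale_right_scale:
    "left_scale \<sigma> k (right_scale a l) = right_scale (left_scale \<sigma> k a) l"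
  and right_scale_right_scale: "right_scale (right_scale a k) l = right_scale a (k * l)"
  and left_scale_one [simp]: "left_scale \<sigma> 1 a = a"
  and right_scale_one [simp]: "right_scale a 1 = a"
  by (cases a; simp add: algebra_defs twisted_simps)+

lemma left_scale_cancel:
  assumes "k \<noteq> 0"
  shows "left_scale \<sigma> k a = left_scale \<sigma> k b \<longleftrightarrow> a = b"
  using assms by (cases a; cases b) (simp add: left_scale_def)

lemma one_mul: "(1, 0) \<odot> x = x"
  by (cases x) (simp add: alg_mult_def)

text \<open>Since \<open>conjugate y\<close> inverts multiplication by \<open>y\<close> up to the determinant, the only \<open>a\<close> with
  \<open>a \<odot> y = q\<close> is \<open>q \<odot> conjugate y\<close> divided by \<open>det y\<close>. Clearing the denominator describes the span
  as a graph.\<close>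

lemma in_span_iff:
  assumes "y \<noteq> 0"
  shows "(p, q) \<in> span x y \<longleftrightarrow> left_scale \<sigma> (det y) p = (q \<odot> conjugate y) \<odot> x"
proof
  assume "(p, q) \<in> span x y"
  then obtain a where "p = a \<odot> x" "q = a \<odot> y"
    by (auto simp: alg_span_def)
  then show "left_scale \<sigma> (det y) p = (q \<odot> conjugate y) \<odot> x"
    by (simp add: mul_conjugate left_scale_mul)
next
  assume *: "left_scale \<sigma> (det y) p = (q \<odot> conjugate y) \<odot> x"
  note nz = det_nonzero[OF assms]
  let ?a = "left_scale \<sigma> (inverse (det y)) (q \<odot> conjugate y)"
  have "?a \<odot> x = p" "?a \<odot> y = q"
    using nz by (simp_all add: left_scale_mul conjugate_mul left_scale_left_scale flip: *)
  then show "(p, q) \<in> span x y"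
    unfolding alg_span_def mem_Collect_eq by (intro exI[of _ ?a]) simp
qed

section \<open>The two ways in which spans coincide\<close>

text \<open>By \<open>a(kx) = (ak)x\<close>, the scalar \<open>k\<close> only reparametrises the span.\<close>

lemma span_left_scale:
  assumes "k \<noteq> 0"
  shows "span (left_scale \<sigma> k x) (left_scale \<sigma> k y) = span x y"
proof -
  have "surj (\<lambda>a. right_scale a k)"
    by (rule surjI[where f = "\<lambda>a. right_scale a (inverse k)"])
      (use assms in \<open>simp add: right_scale_right_scale\<close>)
  moreover have range: "span u v = range (\<lambda>a. (a \<odot> u, a \<odot> v))" for u v
    by (auto simp: alg_span_def)
  ultimately have "span x y = (\<lambda>a. (a \<odot> x, a \<odot> y)) ` range (\<lambda>a. right_scale a k)"
    by simp
  then show ?thesis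
    by (simp add: range mul_left_scale image_image)
qed

lemma span_right_scale:
  assumes "y \<noteq> 0"
  shows "span (right_scale y m) y = {(right_scale q m, q) |q. True}"
proof -
  have "(p, q) \<in> span (right_scale y m) y \<longleftrightarrow> p = right_scale q m" for p q
    using assms det_nonzero[OF assms]
    by (simp add: in_span_iff mul_right_scale conjugate_mul left_scale_cancel
        flip: left_scale_right_scale)
  then show ?thesis
    by auto
qed

section \<open>Comparing the matrices of two equal spans\<close>

definition cross :: "'e \<times> 'e \<Rightarrow> 'e \<times> 'e \<Rightarrow> 'e" where
  "cross x y = fst x * snd y + snd x * fst y"

text \<open>As signs do not matter in characteristic two, the cross term is the determinant with rows \<open>x\<close>
  and \<open>y\<close>, so its vanishing means that these rows are proportional.\<close>

lemma cross_eq_0_imp_right_scale: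
  assumes "cross x y = 0" "x \<noteq> 0" "y \<noteq> 0"
  obtains m where "m \<noteq> 0" "x = right_scale y m"
proof -
  define m where "m = (if fst y = 0 then snd x / snd y else fst x / fst y)"
  have "x = right_scale y m"
    using assms(1,3)
    by (cases x; cases y) (auto simp: cross_def m_def right_scale_def zero_prod_def add_eq_0_iff_eq
        field_simps)
  moreover from this have "m \<noteq> 0"
    using assms(2) by (cases y) (auto simp: right_scale_def zero_prod_def)
  ultimately show thesis
    using that by blast
qed

lemma span_eq_imp_map_eq:
  assumes "span x y = span x' y'" "y \<noteq> 0" "y' \<noteq> 0"
  shows "left_scale \<sigma> (det y') ((q \<odot> conjugate y) \<odot> x) =
    left_scale \<sigma> (det y) ((q \<odot> conjugate y') \<odot> x')"
proof -
  define p where "p = left_scale \<sigma> (inverse (det y)) ((q \<odot> conjugate y) \<odot> x)"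
  have p: "left_scale \<sigma> (det y) p = (q \<odot> conjugate y) \<odot> x"
    using det_nonzero[OF assms(2)] by (simp add: p_def left_scale_left_scale)
  then have "(p, q) \<in> span x' y'"
    using assms by (simp flip: in_span_iff)
  then have p': "left_scale \<sigma> (det y') p = (q \<odot> conjugate y') \<odot> x'"
    using assms(3) by (simp add: in_span_iff)
  show ?thesis
    by (simp add: left_scale_left_scale mult.commute flip: p p')
qed

text \<open>The rows of the matrix of \<open>ay \<mapsto> ax\<close> are its values at \<open>(1, 0)\<close> and \<open>(0, 1)\<close>. Second
  components carry the factor \<open>\<sigma> (det y')\<close> because left scaling is twisted there; that is how the
  cross term comes with both \<open>det y'\<close> and its image under \<open>\<sigma>\<close>.\<close>

lemma span_eq_imp_matrix_eq:
  assumes "span x y = span x' y'" "y \<noteq> 0" "y' \<noteq> 0"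
  defines "D \<equiv> \<lambda>t u v. \<sigma> (fst v) * fst u + t * \<sigma> (snd v) * snd u"
  shows "det y' * D \<omega> x y = det y * D \<omega> x' y'"
    and "\<sigma> (det y') * D (\<sigma> \<omega>) x y = \<sigma> (det y) * D (\<sigma> \<omega>) x' y'"
    and "det y' * cross x y = det y * cross x' y'"
    and "\<sigma> (det y') * cross x y = \<sigma> (det y) * cross x' y'"
proof -
  have row1: "((1, 0) \<odot> conjugate v) \<odot> u = (D \<omega> u v, cross u v)" for u v
    by (cases u; cases v) (simp add: alg_mult_def conjugate_def D_def cross_def twisted_simps)
  have row2: "((0, 1) \<odot> conjugate v) \<odot> u = (\<omega> * cross u v, D (\<sigma> \<omega>) u v)" for u v
    by (cases u; cases v) (simp add: alg_mult_def conjugate_def D_def cross_def twisted_simps)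
  note eq = span_eq_imp_map_eq[OF assms(1-3)]
  show "det y' * D \<omega> x y = det y * D \<omega> x' y'"
    "\<sigma> (det y') * cross x y = \<sigma> (det y) * cross x' y'"
    using eq[of "(1, 0)"] by (simp_all add: row1 left_scale_def)
  show "\<sigma> (det y') * D (\<sigma> \<omega>) x y = \<sigma> (det y) * D (\<sigma> \<omega>) x' y'"
    "det y' * cross x y = det y * cross x' y'"
    using eq[of "(0, 1)"] \<omega> by (simp_all add: row2 left_scale_def mult.left_commute)
qed

text \<open>Scalars taking \<open>c\<close> to \<open>c'\<close> and \<open>e\<close> to \<open>e'\<close> have \<open>\<sigma>\<close>-twisted product \<open>1\<close>, hence
  coincide, because \<open>\<sigma>\<close> inverts nonzero scalars.\<close>

lemma common_scalar:
  assumes "\<sigma> e * c = \<sigma> e' * c'" "e = 0 \<longleftrightarrow> e' = 0" "c = 0 \<longleftrightarrow> c' = 0" "e \<noteq> 0 \<or> c \<noteq> 0"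
  obtains k where "k \<noteq> 0" "c' = k * c" "e' = k * e"
proof (cases "e = 0")
  case True
  then show thesis
    using assms that[of "c' / c"] by auto
next
  case False
  have "c' = e' / e * c"
    using assms(1,2) False by (simp add: sigma_eq_inverse field_simps)
  then show thesis
    using False assms(2) that[of "e' / e"] by auto
qed

lemma span_eq_cross_nonzero:
  assumes eq: "span x y = span x' y'" and nz: "y \<noteq> 0" "y' \<noteq> 0" and Q: "cross x y \<noteq> 0"
  obtains k where "k \<noteq> 0" "x' = left_scale \<sigma> k x" "y' = left_scale \<sigma> k y"
proof -
  obtain c d e f c' d' e' f' where
    x: "x = (c, d)" and y: "y = (e, f)" and x': "x' = (c', d')" and y': "y' = (e', f')"
    by fastforce
  note entries = span_eq_imp_matrix_eq[OF eq nz]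
  \<comment> \<open>The two relations for the cross term say that the ratio of the determinants is fixed by \<open>\<sigma>\<close>.\<close>
  have "det y' * (det y' * cross x y) = det y' * (det y * cross x y)"
  proof -
    have "det y' * (det y' * cross x y) = det y * (det y * cross x' y')"
      using entries(4) by (simp add: sigma_square power2_eq_square mult.assoc)
    then show ?thesis
      using entries(3) by (simp add: mult.left_commute)
  qed
  then have det: "det y = det y'"
    using Q det_nonzero[OF nz(2)] by simp
  have Q_eq: "cross x' y' = cross x y"
    using entries(3) det det_nonzero[OF nz(2)] by simp
  define h g h' g' where "h = \<sigma> e * c" and "g = \<sigma> f * d" and "h' = \<sigma> e' * c'" and "g' = \<sigma> f' * d'"
  have D: "h + \<omega> * g = h' + \<omega> * g'" "h + \<sigma> \<omega> * g = h' + \<sigma> \<omega> * g'"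
    using entries(1,2) det det_nonzero[OF nz(2)]
    by (simp_all add: x y x' y' h_def g_def h'_def g'_def mult.assoc)
  have "\<sigma> \<omega> \<noteq> \<omega>"
    using \<omega> by (simp add: sigma_square power2_eq_square)
  moreover have "(\<sigma> \<omega> - \<omega>) * (g - g') = 0"
    using D by algebra
  ultimately have g: "g = g'"
    by simp
  then have h: "h = h'"
    using D by simp
  have supp: "e = 0 \<longleftrightarrow> e' = 0" "f = 0 \<longleftrightarrow> f' = 0"
    using det_eq_support[OF det] by (simp_all add: y y')
  have Qs: "c * f + d * e \<noteq> 0" "c' * f' + d' * e' \<noteq> 0"
    "c' * f' + d' * e' = c * f + d * e"
    using Q Q_eq by (simp_all add: x y x' y' cross_def)
  have "c = 0 \<longleftrightarrow> c' = 0"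
    using h supp Qs(1,2) by (cases "e = 0") (auto simp: h_def h'_def)
  moreover have "e \<noteq> 0 \<or> c \<noteq> 0"
    using Qs(1) by auto
  ultimately obtain k where k: "k \<noteq> 0" "c' = k * c" "e' = k * e"
    using common_scalar[of e c e' c'] h supp by (auto simp: h_def h'_def)
  have "d = 0 \<longleftrightarrow> d' = 0"
    using g supp Qs(1,2) by (cases "f = 0") (auto simp: g_def g'_def)
  moreover have "f \<noteq> 0 \<or> d \<noteq> 0"
    using Qs(1) by auto
  ultimately obtain l where l: "l \<noteq> 0" "d' = l * d" "f' = l * f"
    using common_scalar[of f d f' d'] g supp by (auto simp: g_def g'_def)
  have "(k * l) * (c * f + d * e) = c * f + d * e"
    using Qs(3) by (simp add: k l algebra_simps)
  then have "k * l = 1"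
    using Qs(1) by simp
  then have "l = \<sigma> k"
    using k(1) by (simp add: sigma_eq_inverse inverse_unique)
  then show thesis
    using that[of k] k l by (simp add: x y x' y' left_scale_def)
qed

lemma span_eq_cross_zero:
  assumes eq: "span x y = span x' y'" and nz: "y \<noteq> 0" "x' \<noteq> 0" "y' \<noteq> 0" and Q: "cross x y = 0"
  obtains m where "m \<noteq> 0" "x = right_scale y m" "x' = right_scale y' m"
proof -
  have "cross x' y' = 0"
    using span_eq_imp_matrix_eq(3)[OF eq nz(1,3)] Q det_nonzero[OF nz(1)] by simp
  then obtain m where m: "m \<noteq> 0" "x' = right_scale y' m"
    using cross_eq_0_imp_right_scale nz by blast
  \<comment> \<open>The algebra has the left unit \<open>(1, 0)\<close>, so the span contains its generator.\<close>
  have "(x, y) \<in> span x y"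
    unfolding alg_span_def mem_Collect_eq by (intro exI[of _ "(1, 0)"]) (simp add: one_mul)
  then have "x = right_scale y m"
    using eq m(2) span_right_scale[OF nz(3)] by auto
  then show thesis
    using that m by blast
qed

end

theorem theorem2:
  fixes \<sigma> :: "'e::field \<Rightarrow> 'e" and \<omega> :: 'e and x y x' y' :: "'e \<times> 'e"
  assumes "CARD('e) = 4"
    and "field_automorphism \<sigma>" and "\<sigma> \<noteq> id"
    and "\<omega> \<notin> {0, 1}"
    and "x \<noteq> 0" and "y \<noteq> 0" and "x' \<noteq> 0" and "y' \<noteq> 0"
  shows "alg_span (alg_mult \<sigma> \<omega>) x y = alg_span (alg_mult \<sigma> \<omega>) x' y' \<longleftrightarrow>
    ((\<exists>k. k \<noteq> 0 \<and> x' = left_scale \<sigma> k x \<and> y' = left_scale \<sigma> k y) \<or>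
    (\<exists>m. m \<noteq> 0 \<and> x = right_scale y m \<and> x' = right_scale y' m))"
    (is "?eq \<longleftrightarrow> ?i \<or> ?ii")
proof -
  interpret quartic_algebra \<sigma> \<omega>
    using assms(1-4) by unfold_locales
  show ?thesis
  proof
    assume eq: ?eq
    show "?i \<or> ?ii"
    proof (cases "cross x y = 0")
      case True
      then show ?thesis
        using span_eq_cross_zero[OF eq assms(6-8)] by blast
    next
      case False
      then show ?thesis
        using span_eq_cross_nonzero[OF eq assms(6,8)] by blast
    qed
  next
    assume "?i \<or> ?ii"
    then show ?eq
    proof (elim disjE exE conjE)
      fix k assume "k \<noteq> 0" "x' = left_scale \<sigma> k x" "y' = left_scale \<sigma> k y"
      then show ?eq
        by (simp add: span_left_scale)
    next
      fix m assume "x = right_scale y m" "x' = right_scale y' m"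
      then show ?eq
        by (simp only: span_right_scale assms(6,8) not_False_eq_True)
    qed
  qed
qed

end
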